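(* Let $\alpha,\beta\in(0,1)$ be such that $1,\alpha,\beta$ are linearly independent over $\mathbb{Q}$. Then there does not exist a partition of $\mathbb{N}$ into three or more sets among which are both Webster sequences $W_\alpha=\{\lceil (n-1/2)/\alpha\rceil:n\in\mathbb{N}\}$ and $W_\beta=\{\lceil (n-1/2)/\beta\rceil:n\in\mathbb{N}\}$.
   Context: $\mathbb{N}=\{1,2,3,\dots\}$. *)

theory Defs
  imports "HOL-Analysis.Analysis"
begin

(* For \<alpha> > 0 every ceiling below is at least 1, so the conversion by nat loses nothing. *)
definition webster :: "real \<Rightarrow> nat set" where
  "webster \<alpha> = {nat \<lceil>(real n - 1/2) / \<alpha>\<rceil> | n. n \<ge> 1}"

(* Linear independence over the rationals of a finite family, given as a list. Independence of
   the underlying set does not see repetitions, hence the extra condition distinct. *)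
definition rat_lin_indep :: "real list \<Rightarrow> bool" where
  "rat_lin_indep xs \<longleftrightarrow>
     distinct xs \<and> module.independent (\<lambda>(q::rat) (x::real). of_rat q * x) (set xs)"

interpretation rat_real: vector_space "\<lambda>(q::rat) (x::real). of_rat q * x"
  by unfold_locales (simp_all add: algebra_simps of_rat_add of_rat_mult)

lemma rat_lin_indep_three_iff:
  "rat_lin_indep [x, y, z] \<longleftrightarrow>
     (\<forall>a b c :: rat. of_rat a * x + of_rat b * y + of_rat c * z = 0 \<longrightarrow> a = 0 \<and> b = 0 \<and> c = 0)"
  (is "?L \<longleftrightarrow> ?R")
proof
  assume L: ?L
  show ?R
  proof (intro allI impI)
    fix a b c :: rat
    assume eq: "of_rat a * x + of_rat b * y + of_rat c * z = 0"
    have d: "x \<noteq> y" "x \<noteq> z" "y \<noteq> z"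
      and ind: "module.independent (\<lambda>(q::rat) (x::real). of_rat q * x) {x, y, z}"
      using L by (auto simp: rat_lin_indep_def)
    define u where "u = (\<lambda>t. if t = x then a else if t = y then b else c)"
    have "(\<Sum>t\<in>{x, y, z}. of_rat (u t) * t) = 0"
      using d eq by (simp add: u_def add.assoc)
    then have "u t = 0" if "t \<in> {x, y, z}" for t
      using rat_real.independentD[OF ind _ subset_refl, of u t] that by simp
    from this[of x] this[of y] this[of z] d show "a = 0 \<and> b = 0 \<and> c = 0"
      by (simp add: u_def)
  qed
next
  assume R: ?R
  have d: "x \<noteq> y" "x \<noteq> z" "y \<noteq> z"
    using R[rule_format, of 1 "-1" 0] R[rule_format, of 1 0 "-1"] R[rule_format, of 0 1 "-1"]
    by (auto simp: of_rat_minus)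
  have "u v = 0" if "(\<Sum>t\<in>{x, y, z}. of_rat (u t) * t) = 0" "v \<in> {x, y, z}" for u v
    using R[rule_format, of "u x" "u y" "u z"] that d by (auto simp: add.assoc)
  then have "module.independent (\<lambda>(q::rat) (x::real). of_rat q * x) {x, y, z}"
    by (subst rat_real.independent_if_scalars_zero) auto
  with d show ?L
    by (simp add: rat_lin_indep_def)
qed

end

theory Submission
  imports Defs
begin

text \<open>A positive integer \<open>m\<close> lies in \<open>W\<^sub>\<alpha>\<close> iff the interval \<open>(\<alpha>(m - 1), \<alpha>m]\<close> contains
  a half-integer, that is, iff the fractional part of \<open>\<alpha>m + 1/2\<close> is less than \<open>\<alpha>\<close>. By Kronecker's
  theorem the pairs \<open>(\<alpha>m, \<beta>m)\<close> are dense modulo 1, so some \<open>m\<close> lies in both sets, and some \<open>m\<close>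
  lies in the first but not in the second. Hence the two sets are neither disjoint nor equal.\<close>

text \<open>\<open>Kronecker_thm_2\<close> asks for independence over the integers; an integer
  relation is a rational one with coefficients \<open>of_int (u x)\<close>.\<close>

lemma independent_over_int_if_rat_lin_indep:
  assumes "rat_lin_indep xs"
  shows "module.independent (\<lambda>r. (*) (real_of_int r)) (set xs)"
proof -
  interpret int_real: Modules.module "\<lambda>r. (*) (real_of_int r)"
    by (simp add: Modules.module.intro distrib_left mult.commute)
  have ind: "module.independent (\<lambda>(q::rat) (x::real). of_rat q * x) (set xs)"
    using assms by (simp add: rat_lin_indep_def)
  have "u v = 0" if "(\<Sum>x\<in>set xs. real_of_int (u x) * x) = 0" and v: "v \<in> set xs"
    for u :: "real \<Rightarrow> int" and v
  proof -
    have "(\<Sum>x\<in>set xs. of_rat (of_int (u x)) * x) = 0"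
      using that(1) by simp
    then have "(of_int (u v) :: rat) = 0"
      by (rule rat_real.independentD[OF ind finite_set subset_refl _ v])
    then show ?thesis
      by simp
  qed
  then show ?thesis
    by (auto simp: int_real.dependent_finite)
qed

lemma webster_iff:
  fixes \<alpha> :: real and m :: nat
  assumes "0 < \<alpha>" "1 \<le> m"
  shows "m \<in> webster \<alpha> \<longleftrightarrow> (\<exists>n::int. \<alpha> * (real m - 1) < n - 1/2 \<and> n - 1/2 \<le> \<alpha> * m)"
proof -
  have ceil: "m = nat \<lceil>x / \<alpha>\<rceil> \<longleftrightarrow> \<alpha> * (real m - 1) < x \<and> x \<le> \<alpha> * m" for x
  proof -
    \<comment> \<open>\<open>nat\<close> collapses negative integers to 0, a value excluded by
      \<open>1 \<le> m\<close>.\<close>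
    have "m = nat \<lceil>x / \<alpha>\<rceil> \<longleftrightarrow> \<lceil>x / \<alpha>\<rceil> = int m"
      using assms(2) by auto
    also have "\<dots> \<longleftrightarrow> real m - 1 < x / \<alpha> \<and> x / \<alpha> \<le> real m"
      by (simp add: ceiling_eq_iff)
    finally show ?thesis
      using assms(1) by (simp add: field_simps)
  qed
  show ?thesis
  proof
    assume "m \<in> webster \<alpha>"
    then obtain n :: nat where "m = nat \<lceil>(real n - 1/2) / \<alpha>\<rceil>"
      unfolding webster_def by blast
    then show "\<exists>n::int. \<alpha> * (real m - 1) < n - 1/2 \<and> n - 1/2 \<le> \<alpha> * m"
      unfolding ceil by (intro exI[of _ "int n"]) simp
  next
    assume "\<exists>n::int. \<alpha> * (real m - 1) < n - 1/2 \<and> n - 1/2 \<le> \<alpha> * m"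
    then obtain n :: int where n: "\<alpha> * (real m - 1) < n - 1/2" "n - 1/2 \<le> \<alpha> * m"
      by blast
    \<comment> \<open>This gives \<open>n > 1/2\<close>, so the integer \<open>n\<close> is an
      admissible index of the sequence.\<close>
    have "0 \<le> \<alpha> * (real m - 1)"
      using assms by simp
    with n(1) have "1 \<le> n"
      by linarith
    with n have "m = nat \<lceil>(real (nat n) - 1/2) / \<alpha>\<rceil>" "1 \<le> nat n"
      unfolding ceil by auto
    then show "m \<in> webster \<alpha>"
      unfolding webster_def by blast
  qed
qed

text \<open>Kronecker's theorem yields an integer \<open>k\<close> of unknown sign. The distance of \<open>k\<alpha>\<close>
  from \<open>(\<alpha> + c) / 2\<close> modulo 1 is invariant under \<open>k \<mapsto> 1 - k\<close>, and one of the two is positive.\<close>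

lemma kronecker_half_targets:
  fixes \<alpha> \<beta> \<epsilon> :: real and c d :: int
  assumes "rat_lin_indep [1, \<alpha>, \<beta>]" "0 < \<epsilon>"
  obtains m :: nat and h h' :: int where "1 \<le> m"
    "\<bar>m * \<alpha> - h - (\<alpha> + c) / 2\<bar> < \<epsilon>" "\<bar>m * \<beta> - h' - (\<beta> + d) / 2\<bar> < \<epsilon>"
proof -
  \<comment> \<open>The entry 1 comes last because \<open>Kronecker_thm_2\<close> requires
    \<open>\<theta> n = 1\<close>.\<close>
  define \<theta> where "\<theta> = (\<lambda>i::nat. [\<alpha>, \<beta>, 1] ! i)"
  define t where "t = (\<lambda>i::nat. [(\<alpha> + c) / 2, (\<beta> + d) / 2] ! i)"
  have le2: "{..2} = {0, 1, 2::nat}"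
    by auto
  have img: "\<theta> ` {..2} = set [1, \<alpha>, \<beta>]"
    unfolding le2 \<theta>_def by auto
  have "inj_on \<theta> {..2}"
    using assms(1) unfolding le2 \<theta>_def rat_lin_indep_def by auto
  then obtain k :: int and p :: "nat \<Rightarrow> int" where kp: "\<And>i. i < 2 \<Longrightarrow> \<bar>k * \<theta> i - p i - t i\<bar> < \<epsilon>"
    using Kronecker_thm_2[of \<theta> 2 \<epsilon> t] independent_over_int_if_rat_lin_indep[OF assms(1)] assms(2)
    unfolding img by (auto simp: \<theta>_def)
  have \<alpha>: "\<bar>k * \<alpha> - p 0 - (\<alpha> + c) / 2\<bar> < \<epsilon>" and \<beta>: "\<bar>k * \<beta> - p 1 - (\<beta> + d) / 2\<bar> < \<epsilon>"
    using kp[of 0] kp[of 1] by (simp_all add: \<theta>_def t_def)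
  show thesis
  proof (cases "1 \<le> k")
    case True
    with \<alpha> \<beta> that[of "nat k" "p 0" "p 1"] show ?thesis
      by simp
  next
    case False
    \<comment> \<open>The target \<open>(x + e) / 2\<close> goes to \<open>x - (x + e) / 2\<close>,
      which is smaller by exactly \<open>e\<close>; hence the new integer part
      \<open>- q - e\<close>.\<close>
    have reflect: "\<bar>(1 - k) * x - (- q - e) - (x + e) / 2\<bar> = \<bar>k * x - q - (x + e) / 2\<bar>"
      for x q e :: real
      by (simp add: field_simps abs_if)
    show ?thesis
      by (rule that[of "nat (1 - k)" "- p 0 - c" "- p 1 - d"])
        (use False \<alpha> \<beta> reflect[of \<alpha> "p 0" c] reflect[of \<beta> "p 1" d] in simp_all)
  qed
qed

text \<open>With index \<open>h\<close>, membership reads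
  \<open>-1/2 \<le> m * \<alpha> - h < \<alpha> - 1/2\<close>, an interval with midpoint
  \<open>(\<alpha> - 1) / 2\<close> and radius \<open>\<alpha> / 2\<close>.\<close>

lemma in_webster_if_near:
  fixes \<alpha> :: real and m :: nat and h :: int
  assumes "0 < \<alpha>" "1 \<le> m" "\<bar>m * \<alpha> - h - (\<alpha> - 1) / 2\<bar> < \<alpha> / 2"
  shows "m \<in> webster \<alpha>"
  unfolding webster_iff[OF assms(1,2)]
  using assms(3) by (intro exI[of _ h]) (simp add: field_simps abs_less_iff)

text \<open>The complementary interval modulo 1, from \<open>\<alpha> - 1/2\<close> to
  \<open>1/2\<close>, has midpoint \<open>\<alpha> / 2\<close>. There an index would lie strictly
  between \<open>h\<close> and \<open>h + 1\<close>.\<close>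

lemma not_in_webster_if_near:
  fixes \<alpha> :: real and m :: nat and h :: int
  assumes "0 < \<alpha>" "1 \<le> m" "\<bar>m * \<alpha> - h - \<alpha> / 2\<bar> < (1 - \<alpha>) / 2"
  shows "m \<notin> webster \<alpha>"
proof
  assume "m \<in> webster \<alpha>"
  then obtain n :: int where n: "\<alpha> * (real m - 1) < n - 1/2" "n - 1/2 \<le> \<alpha> * m"
    unfolding webster_iff[OF assms(1,2)] by blast
  with assms(3) have "real_of_int h < n" "real_of_int n < real_of_int (h + 1)"
    by (auto simp: field_simps abs_less_iff)
  then show False
    unfolding of_int_less_iff by linarith
qed

theorem theorem8:
  fixes \<alpha> \<beta> :: real
  assumes "0 < \<alpha>" "\<alpha> < 1" "0 < \<beta>" "\<beta> < 1"
    and "rat_lin_indep [1, \<alpha>, \<beta>]"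
  shows "\<not> (\<exists>P :: nat set set. partition_on {1..} P \<and> (infinite P \<or> card P \<ge> 3) \<and>
              webster \<alpha> \<in> P \<and> webster \<beta> \<in> P)"
proof -
  obtain m :: nat and h h' :: int where "1 \<le> m"
    "\<bar>m * \<alpha> - h - (\<alpha> - 1) / 2\<bar> < min \<alpha> \<beta> / 2" "\<bar>m * \<beta> - h' - (\<beta> - 1) / 2\<bar> < min \<alpha> \<beta> / 2"
    using kronecker_half_targets[OF assms(5), of "min \<alpha> \<beta> / 2" "-1" "-1"] assms(1,3) by auto
  then have "m \<in> webster \<alpha>" "m \<in> webster \<beta>"
    using assms(1,3) in_webster_if_near[of \<alpha> m h] in_webster_if_near[of \<beta> m h'] by auto
  moreover
  \<comment> \<open>The shifts -1 and 0 select the target inside for \<alpha> and outside for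
    \<beta>; the minimum serves both radii.\<close>
  obtain k :: nat and p p' :: int where "1 \<le> k"
    "\<bar>k * \<alpha> - p - (\<alpha> - 1) / 2\<bar> < min \<alpha> (1 - \<beta>) / 2" "\<bar>k * \<beta> - p' - \<beta> / 2\<bar> < min \<alpha> (1 - \<beta>) / 2"
    using kronecker_half_targets[OF assms(5), of "min \<alpha> (1 - \<beta>) / 2" "-1" 0] assms(1,4) by auto
  then have "k \<in> webster \<alpha>" "k \<notin> webster \<beta>"
    using assms(1,3) in_webster_if_near[of \<alpha> k p] not_in_webster_if_near[of \<beta> k p'] by auto
  ultimately show ?thesis
    unfolding partition_on_def disjoint_def by blast
qed

end
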